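(* Let $m:\mathbb{Z}\to\mathbb{C}$ be given by $m(n)=1/\sqrt{|n|}$ for $n\ne 0$ and $m(0)=0$. Then $m$ is a multiplier from $L\log^{1/2}L(\mathbb{T})$ to $L^2(\mathbb{T})$, but $m$ is not a Sidon weight on $\mathbb{T}$.
   Context: $\mathbb{T}$ is the one-dimensional torus (circle group), with dual group $\mathbb{Z}$. $L\log^{1/2}L(\mathbb{T})$ is the space of measurable $f$ on $\mathbb{T}$ with $\int_{\mathbb{T}}|f|\log^{1/2}(1+|f|)\,d\theta<\infty$. A bounded sequence $m=(m(n))_{n\in\mathbb{Z}}$ is a multiplier from $L\log^{1/2}L(\mathbb{T})$ to $L^2(\mathbb{T})$ if $\sum_{n\in\mathbb{Z}}|m(n)\widehat{f}(n)|^2<\infty$ for every $f\in L\log^{1/2}L(\mathbb{T})$. A function $m:\mathbb{Z}\to\mathbb{C}$ is a Sidon weight on $\mathbb{T}$ if there is a constant $S_m>0$ such that $\sum_{n\in\mathrm{supp}(m)}|m(n)\widehat{f}(n)|\le S_m\|f\|_{L^\infty(\mathbb{T})}$ for every trigonometric polynomial $f$ on $\mathbb{T}$ whose Fourier transform is supported in $\mathrm{supp}(m)=\{n: m(n)\neq 0\}$. *)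

theory Defs
  imports "HOL-Probability.Essential_Supremum"
begin

text \<open>
  The circle group is modelled by the angle \<open>\<theta> \<in> [0, 2\<pi>)\<close> with Lebesgue measure. A function on the
  circle is a function of type \<open>real \<Rightarrow> complex\<close>, and only its values on \<open>[0, 2\<pi>)\<close> matter.
\<close>

definition torus :: "real measure" where
  "torus = lebesgue_on {0..<2 * pi}"

text \<open>
  Haar measure is normalised to total mass 1 here. The Bochner integral of a non-integrable function
  is 0 by convention; functions in \<open>L_log_half_L\<close> and trigonometric polynomials are integrable.
\<close>

definition fourier_coeff :: "(real \<Rightarrow> complex) \<Rightarrow> int \<Rightarrow> complex" where
  "fourier_coeff f n =
     (1 / (2 * pi)) *\<^sub>R (LINT \<theta>|torus. f \<theta> * cis (- (of_int n * \<theta>)))"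

definition L_log_half_L :: "(real \<Rightarrow> complex) set" where
  "L_log_half_L = {f \<in> borel_measurable torus.
     (\<integral>\<^sup>+\<theta>. ennreal (cmod (f \<theta>) * sqrt (ln (1 + cmod (f \<theta>)))) \<partial>torus) < \<infinity>}"

definition Linf_norm :: "(real \<Rightarrow> complex) \<Rightarrow> ereal" where
  "Linf_norm f = esssup torus (\<lambda>\<theta>. ereal (cmod (f \<theta>)))"

definition trig_polynomial :: "(real \<Rightarrow> complex) \<Rightarrow> bool" where
  "trig_polynomial f \<longleftrightarrow>
     (\<exists>F c. finite F \<and> f = (\<lambda>\<theta>. \<Sum>n\<in>F. c n * cis (of_int (n :: int) * \<theta>)))"

definition supp :: "(int \<Rightarrow> complex) \<Rightarrow> int set" where
  "supp m = {n. m n \<noteq> 0}"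

definition multiplier_L_log_half_L_L2 :: "(int \<Rightarrow> complex) \<Rightarrow> bool" where
  "multiplier_L_log_half_L_L2 m \<longleftrightarrow>
     bounded (range m) \<and>
     (\<forall>f\<in>L_log_half_L. (\<lambda>n. (cmod (m n * fourier_coeff f n))\<^sup>2) summable_on UNIV)"

text \<open>
  The infinite sum below has only finitely many nonzero terms, since \<open>f\<close> is a trigonometric
  polynomial.
\<close>

definition sidon_weight :: "(int \<Rightarrow> complex) \<Rightarrow> bool" where
  "sidon_weight m \<longleftrightarrow>
     (\<exists>S>0. \<forall>f. trig_polynomial f \<and> supp (fourier_coeff f) \<subseteq> supp m \<longrightarrow>
        ereal (\<Sum>\<^sub>\<infinity>n\<in>supp m. cmod (m n * fourier_coeff f n)) \<le> ereal S * Linf_norm f)"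

end

theory Submission
  imports Defs
begin

text \<open>
  Since \<open>\<Sum>n\<noteq>0. e\<^sup>i\<^sup>n\<^sup>t / \<bar>n\<bar>\<close> is essentially \<open>2 ln (1 / \<bar>sin (t / 2)\<bar>)\<close>, the sum \<open>\<Sum>n. \<bar>m n * fourier_coeff f n\<bar>\<^sup>2\<close> is
  dominated by the logarithmic energy of \<open>\<bar>f\<bar>\<close>. With \<open>\<Phi> a = a * sqrt (ln (1 + a))\<close>, the pointwise bound
  \<open>a * b * ln (1 / s) \<le> 2 * \<Phi> a * \<Phi> b + 4 * (a + b) * s\<^sup>-\<^sup>3\<^sup>/\<^sup>4\<close> reduces this energy to \<open>(\<integral> \<Phi> \<bar>f\<bar>)\<^sup>2\<close> and
  \<open>(\<integral> \<bar>f\<bar>)\<^sup>2\<close>. To stay with finite sums, \<open>\<Sum>n\<le>N. r\<^sup>n e\<^sup>i\<^sup>n\<^sup>t / n\<close> with \<open>r = 1 - 1 / (2 N)\<close> is used: there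
  \<open>r\<^sup>n \<ge> 1/2\<close>, while the tail of the series for \<open>Ln (1 - r e\<^sup>i\<^sup>t)\<close> is at most 2.

  A Sidon weight must be square summable. For signs \<open>\<epsilon>\<close> and \<open>\<Sum>k. (a k)\<^sup>2 = 1\<close>, the Riesz product
  \<open>\<Prod>k. 1 + \<i> * \<epsilon> k * a k * cos (k * \<theta>)\<close> has modulus at most \<open>sqrt (exp 1)\<close>, and its average against
  \<open>\<epsilon> n\<close> over all choices of signs is \<open>\<i> * a n * cos (n * \<theta>)\<close>. Taking \<open>a\<close> proportional to \<open>m\<close> and averaging
  the Sidon inequality bounds the \<open>\<ell>\<^sup>2\<close> norm of \<open>m\<close>, whereas the harmonic series diverges.
\<close>

section \<open>Trigonometric polynomials\<close>

lemma torus_measurable_borel: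
  assumes "f \<in> borel_measurable borel"
  shows "f \<in> borel_measurable torus"
  unfolding torus_def using assms
  by (intro measurable_restrict_space1 measurable_completion) simp

lemma space_torus [simp]: "space torus = {0..<2 * pi}"
  by (simp add: torus_def)

lemma emeasure_torus: "emeasure torus (space torus) = ennreal (2 * pi)"
  unfolding torus_def by (simp add: emeasure_restrict_space)

lemma finite_measure_torus: "finite_measure torus"
  by (rule finite_measureI) (simp add: emeasure_torus del: space_torus)

lemma continuous_on_trig_polynomial:
  assumes "trig_polynomial f"
  shows "continuous_on UNIV f"
proof -
  obtain F c where "finite F" and f: "f = (\<lambda>\<theta>. \<Sum>n\<in>F. c n * cis (of_int (n :: int) * \<theta>))"
    using assms unfolding trig_polynomial_def by blast
  show ?thesis unfolding f by (intro continuous_intros)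
qed

lemma integrable_torus_continuous:
  fixes f :: "real \<Rightarrow> complex"
  assumes "continuous_on UNIV f"
  shows "integrable torus f"
proof -
  interpret finite_measure torus by (rule finite_measure_torus)
  have "compact (f ` {0..2*pi})"
    by (intro compact_continuous_image continuous_on_subset[OF assms]) auto
  then have "bounded (f ` {0..2*pi})" by (rule compact_imp_bounded)
  then obtain B where B: "\<And>x. x \<in> {0..2*pi} \<Longrightarrow> norm (f x) \<le> B"
    unfolding bounded_iff by blast
  show ?thesis
  proof (rule integrable_const_bound)
    show "AE x in torus. norm (f x) \<le> B"
      using B by (intro AE_I2) auto
    show "f \<in> borel_measurable torus"
      by (intro torus_measurable_borel borel_measurable_continuous_onI assms)
  qed
qed

lemma integral_torus_cis:
  "(LINT \<theta>|torus. cis (of_int k * \<theta>)) = (if k = 0 then 2 * pi else 0)"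
proof -
  have int: "integrable torus (\<lambda>\<theta>. cis (of_int k * \<theta>))"
    by (intro integrable_torus_continuous continuous_intros)
  have "(LINT \<theta>|torus. cis (of_int k * \<theta>)) = integral {0..<2*pi} (\<lambda>\<theta>. cis (of_int k * \<theta>))"
    using int unfolding torus_def by (intro lebesgue_integral_eq_integral) auto
  \<comment> \<open>Adding the right endpoint changes only a null set and gives the closed interval
    on which the fundamental theorem of calculus is applied.\<close>
  also have "\<dots> = integral {0..2*pi} (\<lambda>\<theta>. cis (of_int k * \<theta>))"
  proof (rule integral_subset_negligible)
    show "negligible ({0..2*pi} - {0..<2*pi})"
      by (rule negligible_subset[of "{2*pi}"]) auto
  qed auto
  also have "\<dots> = (if k = 0 then 2 * pi else 0)"
  proof (cases "k = 0")
    case False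
    define g where "g = (\<lambda>\<theta>. cis (of_int k * \<theta>) / (\<i> * of_int k))"
    have "((\<lambda>\<theta>. cis (of_int k * \<theta>)) has_integral (g (2*pi) - g 0)) {0..2*pi}"
    proof (rule fundamental_theorem_of_calculus)
      fix x :: real
      show "(g has_vector_derivative cis (of_int k * x)) (at x within {0..2*pi})"
      proof -
        \<comment> \<open>The antiderivative is first differentiated as a holomorphic function; its
          restriction to the real line then has the required vector derivative.\<close>
        define c :: complex where "c = \<i> * of_int k"
        have "c \<noteq> 0" using False by (simp add: c_def)
        have "((\<lambda>z. exp (c * z)) has_field_derivative exp (c * of_real x) * c) (at (of_real x))"
          by (intro DERIV_fun_exp DERIV_cmult_Id)
        from DERIV_cdivide[OF this, of c] \<open>c \<noteq> 0\<close>
        have "((\<lambda>z. exp (c * z) / c) has_field_derivative exp (c * of_real x)) (at (of_real x))"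
          by simp
        from has_vector_derivative_real_field[OF this] show ?thesis
          by (simp add: g_def c_def cis_conv_exp mult_ac)
      qed
    qed auto
    moreover have "g (2*pi) = g 0"
      using cis_multiple_2pi[of "of_int k"] by (simp add: g_def mult_ac)
    ultimately show ?thesis using False by (simp add: integral_unique)
  qed (simp add: scaleR_conv_of_real)
  finally show ?thesis .
qed

lemma fourier_coeff_trig_polynomial:
  assumes "finite F"
  shows "fourier_coeff (\<lambda>\<theta>. \<Sum>n\<in>F. c n * cis (of_int n * \<theta>)) k = (if k \<in> F then c k else 0)"
proof -
  have "(LINT \<theta>|torus. (\<Sum>n\<in>F. c n * cis (of_int n * \<theta>)) * cis (- (of_int k * \<theta>)))
      = (LINT \<theta>|torus. (\<Sum>n\<in>F. c n * cis (of_int (n - k) * \<theta>)))"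
    by (simp add: sum_distrib_right mult.assoc cis_mult left_diff_distrib)
  also have "\<dots> = (\<Sum>n\<in>F. (LINT \<theta>|torus. c n * cis (of_int (n - k) * \<theta>)))"
    by (intro Bochner_Integration.integral_sum integrable_torus_continuous continuous_intros)
  also have "\<dots> = (\<Sum>n\<in>F. c n * (if n - k = 0 then 2 * pi else 0))"
    by (simp only: integral_mult_right_zero integral_torus_cis)
  also have "\<dots> = (if k \<in> F then 2 * pi * c k else 0)"
    using assms by (simp add: if_distrib cong: if_cong)
  finally show ?thesis
    unfolding fourier_coeff_def by (simp add: scaleR_conv_of_real)
qed

lemma fourier_coeff_sum:
  assumes "\<And>i. i \<in> I \<Longrightarrow> continuous_on UNIV (f i)"
  shows "fourier_coeff (\<lambda>\<theta>. \<Sum>i\<in>I. c i * f i \<theta>) n = (\<Sum>i\<in>I. c i * fourier_coeff (f i) n)"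
proof -
  have "(LINT \<theta>|torus. (\<Sum>i\<in>I. c i * f i \<theta>) * cis (- (of_int n * \<theta>)))
      = (LINT \<theta>|torus. (\<Sum>i\<in>I. c i * (f i \<theta> * cis (- (of_int n * \<theta>)))))"
    by (simp add: sum_distrib_right mult.assoc)
  also have "\<dots> = (\<Sum>i\<in>I. (LINT \<theta>|torus. c i * (f i \<theta> * cis (- (of_int n * \<theta>)))))"
    by (intro Bochner_Integration.integral_sum integrable_torus_continuous continuous_intros assms)
  also have "\<dots> = (\<Sum>i\<in>I. c i * (LINT \<theta>|torus. f i \<theta> * cis (- (of_int n * \<theta>))))"
    by (simp only: integral_mult_right_zero)
  finally show ?thesis
    by (simp add: fourier_coeff_def scaleR_sum_right)
qed

lemma fourier_coeff_diff:
  assumes "continuous_on UNIV f" "continuous_on UNIV g"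
  shows "fourier_coeff (\<lambda>\<theta>. f \<theta> - g \<theta>) n = fourier_coeff f n - fourier_coeff g n"
proof -
  have "(LINT \<theta>|torus. (f \<theta> - g \<theta>) * cis (- (of_int n * \<theta>)))
      = (LINT \<theta>|torus. f \<theta> * cis (- (of_int n * \<theta>)) - g \<theta> * cis (- (of_int n * \<theta>)))"
    by (simp add: left_diff_distrib)
  also have "\<dots> = (LINT \<theta>|torus. f \<theta> * cis (- (of_int n * \<theta>)))
                 - (LINT \<theta>|torus. g \<theta> * cis (- (of_int n * \<theta>)))"
    by (intro Bochner_Integration.integral_diff integrable_torus_continuous continuous_intros assms)
  finally show ?thesis
    by (simp add: fourier_coeff_def scaleR_diff_right)
qed

lemma fourier_coeff_const: "fourier_coeff (\<lambda>\<theta>. c) n = (if n = 0 then c else 0)"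
  using fourier_coeff_trig_polynomial[of "{0}" "\<lambda>_. c" n] by simp

text \<open>Averaging against a unimodular function over a space of normalised mass 1 cannot exceed
  the sup bound. With \<open>n = 0\<close> this controls the mean that is later removed from a Riesz
  product.\<close>

lemma norm_fourier_coeff_le:
  assumes "\<And>\<theta>. norm (f \<theta>) \<le> B" and "continuous_on UNIV f"
  shows "norm (fourier_coeff f n) \<le> B"
proof -
  interpret finite_measure torus by (rule finite_measure_torus)
  have m: "measure torus (space torus) = 2 * pi"
    using emeasure_torus by (simp add: measure_def)
  have "norm (LINT \<theta>|torus. f \<theta> * cis (- (of_int n * \<theta>))) \<le> (LINT \<theta>|torus. B)"
    using assms
    by (intro order.trans[OF integral_norm_bound] integral_mono integrable_norm
        integrable_torus_continuous continuous_intros) (auto simp: norm_mult)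
  also have "\<dots> = 2 * pi * B" using m by simp
  finally show ?thesis by (simp add: fourier_coeff_def field_simps)
qed

section \<open>Closure properties of trigonometric polynomials\<close>

lemma trig_polynomial_const: "trig_polynomial (\<lambda>_. c)"
  unfolding trig_polynomial_def
  by (intro exI[of _ "{0}"] exI[of _ "\<lambda>_. c"]) auto

lemma trig_polynomial_cis: "trig_polynomial (\<lambda>\<theta>. c * cis (of_int n * \<theta>))"
  unfolding trig_polynomial_def
  by (intro exI[of _ "{n}"] exI[of _ "\<lambda>_. c"]) auto

lemma trig_polynomial_add:
  assumes "trig_polynomial f" "trig_polynomial g"
  shows "trig_polynomial (\<lambda>\<theta>. f \<theta> + g \<theta>)"
proof -
  obtain F c where F: "finite F" "f = (\<lambda>\<theta>. \<Sum>n\<in>F. c n * cis (of_int (n :: int) * \<theta>))"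
    using assms unfolding trig_polynomial_def by blast
  obtain G d where G: "finite G" "g = (\<lambda>\<theta>. \<Sum>n\<in>G. d n * cis (of_int (n :: int) * \<theta>))"
    using assms unfolding trig_polynomial_def by blast
  \<comment> \<open>Extending both coefficient families by zero to the common frequency set
    \<open>F \<union> G\<close> lets them be added termwise.\<close>
  let ?c = "\<lambda>n. if n \<in> F then c n else 0" and ?d = "\<lambda>n. if n \<in> G then d n else 0"
  have "f = (\<lambda>\<theta>. \<Sum>n\<in>F \<union> G. ?c n * cis (of_int n * \<theta>))" unfolding F(2)
    by (rule ext, rule sum.mono_neutral_cong_left) (use F G in auto)
  moreover have "g = (\<lambda>\<theta>. \<Sum>n\<in>F \<union> G. ?d n * cis (of_int n * \<theta>))" unfolding G(2)
    by (rule ext, rule sum.mono_neutral_cong_left) (use F G in auto)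
  ultimately have "(\<lambda>\<theta>. f \<theta> + g \<theta>) = (\<lambda>\<theta>. \<Sum>n\<in>F \<union> G. (?c n + ?d n) * cis (of_int n * \<theta>))"
    by (simp only: sum.distrib distrib_right)
  then show ?thesis
    unfolding trig_polynomial_def using F(1) G(1)
    by (intro exI[of _ "F \<union> G"] exI[of _ "\<lambda>n. ?c n + ?d n"]) simp
qed

lemma trig_polynomial_sum:
  assumes "\<And>i. i \<in> I \<Longrightarrow> trig_polynomial (f i)"
  shows "trig_polynomial (\<lambda>\<theta>. \<Sum>i\<in>I. f i \<theta>)"
  using assms
  by (induction I rule: infinite_finite_induct)
    (auto intro: trig_polynomial_add trig_polynomial_const)

text \<open>Different pairs \<open>(n, k)\<close> may give the same frequency \<open>n + k\<close>.
  Instead of collecting coefficients, the product is written as a double sum of monomials, and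
  closure under sums does the rest.\<close>

lemma trig_polynomial_mult:
  assumes "trig_polynomial f" "trig_polynomial g"
  shows "trig_polynomial (\<lambda>\<theta>. f \<theta> * g \<theta>)"
proof -
  obtain F c where F: "finite F" "f = (\<lambda>\<theta>. \<Sum>n\<in>F. c n * cis (of_int (n :: int) * \<theta>))"
    using assms unfolding trig_polynomial_def by blast
  obtain G d where G: "finite G" "g = (\<lambda>\<theta>. \<Sum>n\<in>G. d n * cis (of_int (n :: int) * \<theta>))"
    using assms unfolding trig_polynomial_def by blast
  have "(\<lambda>\<theta>. f \<theta> * g \<theta>) = (\<lambda>\<theta>. \<Sum>n\<in>F. \<Sum>k\<in>G. (c n * d k) * cis (of_int (n + k) * \<theta>))"
    unfolding F(2) G(2) sum_product
    by (simp add: distrib_right flip: cis_mult) (simp add: mult_ac)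
  moreover have "trig_polynomial \<dots>"
    by (intro trig_polynomial_sum trig_polynomial_cis)
  ultimately show ?thesis by simp
qed

lemma trig_polynomial_prod:
  assumes "\<And>i. i \<in> I \<Longrightarrow> trig_polynomial (f i)"
  shows "trig_polynomial (\<lambda>\<theta>. \<Prod>i\<in>I. f i \<theta>)"
  using assms
  by (induction I rule: infinite_finite_induct)
    (auto intro: trig_polynomial_mult trig_polynomial_const)

lemma cos_eq_cis: "complex_of_real (cos x) = (cis x + cis (- x)) / 2"
  by (simp add: complex_eq_iff)

lemma trig_polynomial_cos: "trig_polynomial (\<lambda>\<theta>. c * complex_of_real (cos (real k * \<theta>)))"
proof -
  have "(\<lambda>\<theta>. c * complex_of_real (cos (real k * \<theta>)))
      = (\<lambda>\<theta>. c / 2 * cis (of_int (int k) * \<theta>) + c / 2 * cis (of_int (- int k) * \<theta>))"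
    by (simp add: cos_eq_cis algebra_simps add_divide_distrib)
  then show ?thesis by (simp only: trig_polynomial_add trig_polynomial_cis)
qed

text \<open>For \<open>n > 0\<close> the two frequencies \<open>n\<close> and \<open>- n\<close> of
  the cosine are distinct, so each carries half of the amplitude.\<close>

lemma fourier_coeff_cos:
  assumes "n > 0"
  shows "fourier_coeff (\<lambda>\<theta>. c * complex_of_real (cos (real n * \<theta>))) (int n) = c / 2"
proof -
  have "(\<lambda>\<theta>. c * complex_of_real (cos (real n * \<theta>)))
      = (\<lambda>\<theta>. \<Sum>k\<in>{int n, - int n}. c / 2 * cis (of_int k * \<theta>))"
    using assms by (simp add: cos_eq_cis algebra_simps add_divide_distrib)
  then show ?thesis
    using fourier_coeff_trig_polynomial[of "{int n, - int n}" "\<lambda>_. c / 2" "int n"] by simp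
qed

text \<open>This makes the infinite sum in the Sidon inequality genuinely summable, so that it does
  not take the default value 0.\<close>

lemma finite_supp_fourier_coeff:
  assumes "trig_polynomial f"
  shows "finite (supp (fourier_coeff f))"
proof -
  obtain F c where F: "finite F" "f = (\<lambda>\<theta>. \<Sum>n\<in>F. c n * cis (of_int (n :: int) * \<theta>))"
    using assms unfolding trig_polynomial_def by blast
  have "supp (fourier_coeff f) \<subseteq> F"
    unfolding F(2) supp_def using fourier_coeff_trig_polynomial[OF F(1)] by auto
  then show ?thesis using F(1) finite_subset by blast
qed

section \<open>Sidon weights are square summable\<close>

text \<open>The Rademacher average against \<open>\<epsilon> n\<close> isolates the term of the expanded product that is linear
  in \<open>b n\<close> alone.\<close>

lemma sum_signs_prod:
  fixes b :: "nat \<Rightarrow> complex"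
  assumes "finite I" "n \<in> I"
  shows "(\<Sum>\<epsilon>\<in>I \<rightarrow>\<^sub>E {-1, 1}. \<epsilon> n * (\<Prod>k\<in>I. 1 + \<epsilon> k * b k)) = 2 ^ card I * b n"
proof -
  have "(\<Sum>\<epsilon>\<in>I \<rightarrow>\<^sub>E {-1, 1}. \<epsilon> n * (\<Prod>k\<in>I. 1 + \<epsilon> k * b k))
      = (\<Sum>\<epsilon>\<in>I \<rightarrow>\<^sub>E {-1, 1}. \<Prod>k\<in>I. (if k = n then \<epsilon> k else 1) * (1 + \<epsilon> k * b k))"
    using assms by (simp add: prod.distrib)
  also have "\<dots> = (\<Prod>k\<in>I. \<Sum>s\<in>{-1, 1}. (if k = n then s else 1) * (1 + s * b k))"
    by (rule prod_sum_PiE[symmetric]) (use assms in auto)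
  \<comment> \<open>Over \<open>s = -1\<close> and \<open>s = 1\<close>, the sum of
    \<open>1 + s * b k\<close> is 2, while at \<open>k = n\<close> the extra factor \<open>s\<close>
    cancels the constant and leaves \<open>2 * b n\<close>.\<close>
  also have "\<dots> = (\<Prod>k\<in>I. 2 * (if k = n then b k else 1))"
    by (intro prod.cong) auto
  also have "\<dots> = 2 ^ card I * b n"
    using assms by (simp add: prod.distrib)
  finally show ?thesis .
qed

text \<open>The factor \<i> makes every perturbation purely imaginary, so the squared modulus of a
  factor is \<open>1 + (a k * cos (k * \<theta>))\<^sup>2\<close>, with no first-order term. The
  squared moduli then multiply to at most \<open>exp 1\<close>, which is below 4.\<close>

lemma norm_riesz_product_le:
  fixes a :: "nat \<Rightarrow> real" and \<epsilon> :: "nat \<Rightarrow> complex"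
  assumes "finite I" and "\<And>k. k \<in> I \<Longrightarrow> \<epsilon> k \<in> {-1, 1}" and "(\<Sum>k\<in>I. (a k)\<^sup>2) \<le> 1"
  shows "norm (\<Prod>k\<in>I. 1 + \<epsilon> k * (\<i> * of_real (a k) * of_real (cos (real k * \<theta>)))) \<le> 2"
proof -
  have 1: "(norm (1 + \<epsilon> k * (\<i> * of_real (a k) * of_real (cos (real k * \<theta>)))))\<^sup>2 \<le> exp ((a k)\<^sup>2)"
    if "k \<in> I" for k
  proof -
    have "(norm (1 + \<epsilon> k * (\<i> * of_real (a k) * of_real (cos (real k * \<theta>)))))\<^sup>2
        = 1 + (a k * cos (real k * \<theta>))\<^sup>2"
      using assms(2)[OF that] by (elim insertE emptyE) (simp_all add: cmod_power2)
    also have "\<dots> \<le> 1 + (a k)\<^sup>2"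
      unfolding power_mult_distrib
      by (intro add_left_mono mult_left_le) (simp_all add: abs_square_le_1)
    also have "\<dots> \<le> exp ((a k)\<^sup>2)" by (rule exp_ge_add_one_self)
    finally show ?thesis .
  qed
  have "(norm (\<Prod>k\<in>I. 1 + \<epsilon> k * (\<i> * of_real (a k) * of_real (cos (real k * \<theta>)))))\<^sup>2
      = (\<Prod>k\<in>I. (norm (1 + \<epsilon> k * (\<i> * of_real (a k) * of_real (cos (real k * \<theta>)))))\<^sup>2)"
    by (simp add: prod_norm[symmetric] prod_power_distrib)
  also have "\<dots> \<le> (\<Prod>k\<in>I. exp ((a k)\<^sup>2))"
    by (intro prod_mono) (use 1 in auto)
  also have "\<dots> = exp (\<Sum>k\<in>I. (a k)\<^sup>2)" using assms(1) by (simp add: exp_sum)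
  also have "\<dots> \<le> exp 1" using assms(3) by simp
  also have "\<dots> \<le> 2\<^sup>2" using exp_le by simp
  finally show ?thesis by (rule power2_le_imp_le) simp
qed

text \<open>The 8 is a product of three factors 2: the sup bound of the Riesz product, the removal
  of its mean, and the coefficient 1/2 of a cosine.\<close>

lemma sidon_weight_imp_square_summable:
  assumes "\<forall>f. trig_polynomial f \<and> supp (fourier_coeff f) \<subseteq> supp m \<longrightarrow>
        ereal (\<Sum>\<^sub>\<infinity>n\<in>supp m. cmod (m n * fourier_coeff f n)) \<le> ereal S * Linf_norm f"
    and "supp m = - {0}" and "S \<ge> 0"
  shows "(\<Sum>n=1..N. (cmod (m (int n)))\<^sup>2) \<le> (8 * S)\<^sup>2"
proof (cases "(\<Sum>n=1..N. (cmod (m (int n)))\<^sup>2) = 0")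
  case True
  then show ?thesis by simp
next
  case False
  define A where "A = (\<Sum>n=1..N. (cmod (m (int n)))\<^sup>2)"
  have A: "A > 0" using False sum_nonneg[of "{1..N}" "\<lambda>n. (cmod (m (int n)))\<^sup>2"] by (simp add: A_def less_le)
  \<comment> \<open>Dividing by \<open>sqrt A\<close> gives the normalisation under which the Riesz
    products are bounded; this is why \<open>A = 0\<close> is treated separately.\<close>
  define a where "a k = cmod (m (int k)) / sqrt A" for k
  have "(\<Sum>k=1..N. (a k)\<^sup>2) = (\<Sum>k=1..N. (cmod (m (int k)))\<^sup>2) / A"
    using A by (simp add: a_def power_divide sum_divide_distrib)
  also have "\<dots> = 1" unfolding A_def[symmetric] using A by simp
  finally have a1: "(\<Sum>k=1..N. (a k)\<^sup>2) = 1" .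
  define E where "E = ({1..N} \<rightarrow>\<^sub>E {-1, 1 :: complex})"
  define b where "b \<theta> k = \<i> * of_real (a k) * of_real (cos (real k * \<theta>))" for \<theta> k
  define f where "f \<epsilon> \<theta> = (\<Prod>k=1..N. 1 + \<epsilon> k * b \<theta> k)" for \<epsilon> \<theta>
  have finE: "finite E" unfolding E_def by (intro finite_PiE) auto
  have "card E = 2 ^ N" by (simp add: E_def card_PiE numeral_2_eq_2)
  have tf: "trig_polynomial (f \<epsilon>)" for \<epsilon>
  proof -
    have "trig_polynomial (\<lambda>\<theta>. \<epsilon> k * b \<theta> k)" for k
      using trig_polynomial_cos[of "\<epsilon> k * \<i> * of_real (a k)" k] by (simp add: b_def mult_ac)
    then show ?thesis unfolding f_def
      by (intro trig_polynomial_prod trig_polynomial_add trig_polynomial_const)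
  qed
  have cf: "continuous_on UNIV (f \<epsilon>)" for \<epsilon>
    using tf by (rule continuous_on_trig_polynomial)
  have f2: "norm (f \<epsilon> \<theta>) \<le> 2" if "\<epsilon> \<in> E" for \<epsilon> \<theta>
    unfolding f_def b_def
    by (rule norm_riesz_product_le) (use that a1 in \<open>auto simp: E_def PiE_def Pi_def\<close>)
  have bound: "(\<Sum>n=1..N. cmod (m (int n)) * cmod (fourier_coeff (f \<epsilon>) (int n))) \<le> 4 * S"
    if e: "\<epsilon> \<in> E" for \<epsilon>
  proof -
    \<comment> \<open>Frequency 0 lies outside the support of \<open>m\<close>, so the mean must be
      removed before the Sidon inequality applies. All other coefficients stay the same, and the sup
      bound grows from 2 to 4.\<close>
    define g where "g \<theta> = f \<epsilon> \<theta> - fourier_coeff (f \<epsilon>) 0" for \<theta>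
    have tg: "trig_polynomial g"
      using trig_polynomial_add[OF tf trig_polynomial_const, of \<epsilon> "- fourier_coeff (f \<epsilon>) 0"]
      by (simp add: g_def [abs_def])
    have g: "fourier_coeff g n = (if n = 0 then 0 else fourier_coeff (f \<epsilon>) n)" for n
      unfolding g_def by (subst fourier_coeff_diff) (auto simp: cf fourier_coeff_const)
    have "norm (g \<theta>) \<le> 4" for \<theta>
      unfolding g_def
      using f2[OF e] norm_fourier_coeff_le[OF f2[OF e] cf]
      by (smt (verit) norm_triangle_ineq4)
    moreover have "(\<lambda>\<theta>. ereal (cmod (g \<theta>))) \<in> borel_measurable torus"
      by (intro borel_measurable_ereal torus_measurable_borel borel_measurable_continuous_onI
          continuous_on_norm continuous_on_trig_polynomial tg)
    ultimately have "Linf_norm g \<le> ereal 4"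
      unfolding Linf_norm_def by (intro esssup_I) auto
    have S: "ereal (\<Sum>\<^sub>\<infinity>n\<in>supp m. cmod (m n * fourier_coeff g n)) \<le> ereal S * Linf_norm g"
      using assms tg g by (auto simp: supp_def)
    have "ereal (\<Sum>\<^sub>\<infinity>n\<in>supp m. cmod (m n * fourier_coeff g n)) \<le> ereal S * ereal 4"
      using \<open>Linf_norm g \<le> ereal 4\<close> assms(3) by (intro order.trans[OF S] ereal_mult_left_mono) auto
    then have 4: "(\<Sum>\<^sub>\<infinity>n\<in>supp m. cmod (m n * fourier_coeff g n)) \<le> 4 * S" by simp
    have "(\<Sum>n=1..N. cmod (m (int n)) * cmod (fourier_coeff (f \<epsilon>) (int n)))
        = (\<Sum>n\<in>int ` {1..N}. cmod (m n * fourier_coeff g n))"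
      by (subst sum.reindex) (auto simp: g norm_mult intro!: sum.cong)
    also have "\<dots> = (\<Sum>\<^sub>\<infinity>n\<in>int ` {1..N}. cmod (m n * fourier_coeff g n))"
      by simp
    \<comment> \<open>Passing from the frequencies \<open>1..N\<close> to the whole support only
      adds nonnegative terms.\<close>
    also have "\<dots> \<le> (\<Sum>\<^sub>\<infinity>n\<in>supp m. cmod (m n * fourier_coeff g n))"
    proof (rule infsum_mono_neutral)
      show "(\<lambda>n. cmod (m n * fourier_coeff g n)) summable_on supp m"
      proof (rule finite_nonzero_values_imp_summable_on)
        show "finite {n \<in> supp m. cmod (m n * fourier_coeff g n) \<noteq> 0}"
          by (rule finite_subset[OF _ finite_supp_fourier_coeff[OF tg]]) (auto simp: supp_def)
      qed
      show "(\<lambda>n. cmod (m n * fourier_coeff g n)) summable_on int ` {1..N}" by simp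
      fix n
      show "cmod (m n * fourier_coeff g n) \<le> 0" if "n \<in> int ` {1..N} - supp m"
        using that by (simp add: supp_def)
    qed simp_all
    finally show ?thesis using 4 by simp
  qed
  \<comment> \<open>For each fixed angle \<open>sum_signs_prod\<close> collapses the signed sum to a
    single cosine of frequency \<open>n\<close>; the coefficient is then read off.\<close>
  have avg: "(\<Sum>\<epsilon>\<in>E. \<epsilon> n * fourier_coeff (f \<epsilon>) (int n)) = 2 ^ N * (\<i> * of_real (a n)) / 2"
    if n: "n \<in> {1..N}" for n
  proof -
    have "(\<Sum>\<epsilon>\<in>E. \<epsilon> n * fourier_coeff (f \<epsilon>) (int n))
        = fourier_coeff (\<lambda>\<theta>. \<Sum>\<epsilon>\<in>E. \<epsilon> n * f \<epsilon> \<theta>) (int n)"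
      using fourier_coeff_sum[of E f "\<lambda>\<epsilon>. \<epsilon> n" "int n"] cf by simp
    also have "(\<lambda>\<theta>. \<Sum>\<epsilon>\<in>E. \<epsilon> n * f \<epsilon> \<theta>)
        = (\<lambda>\<theta>. 2 ^ N * (\<i> * of_real (a n)) * of_real (cos (real n * \<theta>)))"
    proof
      fix \<theta> :: real
      show "(\<Sum>\<epsilon>\<in>E. \<epsilon> n * f \<epsilon> \<theta>) = 2 ^ N * (\<i> * of_real (a n)) * of_real (cos (real n * \<theta>))"
        using sum_signs_prod[of "{1..N}" n "b \<theta>"] n by (simp add: E_def f_def b_def)
    qed
    also have "fourier_coeff \<dots> (int n) = 2 ^ N * (\<i> * of_real (a n)) / 2"
      by (rule fourier_coeff_cos) (use n in simp)
    finally show ?thesis .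
  qed
  \<comment> \<open>By the choice of \<open>a\<close>, pairing it with the moduli of
    \<open>m\<close> gives \<open>A / sqrt A = sqrt A\<close>. The factor \<open>2 ^ N / 2\<close>
    is the number of sign patterns times the cosine coefficient 1/2, and it cancels at the
    end.\<close>
  have "2 ^ N / 2 * sqrt A = 2 ^ N / 2 * (A / sqrt A)" using A by (simp add: real_div_sqrt)
  also have "\<dots> = (\<Sum>n=1..N. cmod (m (int n)) * (2 ^ N * a n / 2))"
    unfolding A_def a_def
    by (simp add: sum_distrib_left sum_divide_distrib power2_eq_square mult_ac)
  also have "\<dots> = (\<Sum>n=1..N. cmod (m (int n)) * cmod (\<Sum>\<epsilon>\<in>E. \<epsilon> n * fourier_coeff (f \<epsilon>) (int n)))"
  proof (intro sum.cong refl arg_cong2[where f = "(*)"])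
    fix n assume "n \<in> {1..N}"
    show "2 ^ N * a n / 2 = cmod (\<Sum>\<epsilon>\<in>E. \<epsilon> n * fourier_coeff (f \<epsilon>) (int n))"
      unfolding avg[OF \<open>n \<in> {1..N}\<close>] using A by (simp add: norm_mult norm_divide norm_power a_def)
  qed
  also have "\<dots> \<le> (\<Sum>n=1..N. cmod (m (int n)) * (\<Sum>\<epsilon>\<in>E. cmod (fourier_coeff (f \<epsilon>) (int n))))"
  proof (intro sum_mono mult_left_mono sum_norm_le)
    fix n \<epsilon> assume "n \<in> {1..N}" "\<epsilon> \<in> E"
    then have "\<epsilon> n \<in> {-1, 1}" by (auto simp: E_def)
    then show "cmod (\<epsilon> n * fourier_coeff (f \<epsilon>) (int n)) \<le> cmod (fourier_coeff (f \<epsilon>) (int n))"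
      by (auto simp: norm_mult)
  qed auto
  also have "\<dots> = (\<Sum>\<epsilon>\<in>E. \<Sum>n=1..N. cmod (m (int n)) * cmod (fourier_coeff (f \<epsilon>) (int n)))"
    unfolding sum_distrib_left by (rule sum.swap)
  also have "\<dots> \<le> (\<Sum>\<epsilon>\<in>E. 4 * S)" by (intro sum_mono bound)
  also have "\<dots> = 2 ^ N / 2 * (8 * S)" using \<open>card E = 2 ^ N\<close> by simp
  finally have "sqrt A \<le> 8 * S" by (subst (asm) mult_le_cancel_left_pos) auto
  from power_mono[OF this, of 2] show ?thesis
    unfolding A_def[symmetric] using A by simp
qed

section \<open>The logarithmic energy estimate\<close>

text \<open>The partial sum is \<open>- Ln (1 - z)\<close> minus a tail. Beyond \<open>N\<close> the
  terms are at most \<open>r ^ n / N\<close> after reindexing, and this geometric series sums to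
  \<open>1 / (N * (1 - r)) = 2\<close> for the chosen radius.\<close>

lemma norm_partial_sum_log_le:
  assumes "N > 0" and z: "norm z = 1 - 1 / (2 * real N)"
  shows "norm (\<Sum>n=1..N. z ^ n / of_nat n) \<le> 2 + norm (Ln (1 - z))"
proof -
  define r where "r = norm z"
  have "0 \<le> r" by (simp add: r_def)
  have "r < 1" unfolding r_def z using assms(1) by simp
  note r = \<open>0 \<le> r\<close> \<open>r < 1\<close>
  have "(\<lambda>n. - (- (z ^ n) / of_nat n)) sums - Ln (1 - z)"
    using sums_minus[OF Ln_series'[of "- z"]] r by (simp add: r_def)
  then have s: "(\<lambda>n. z ^ n / of_nat n) sums - Ln (1 - z)" by simp
  define T where "T n = z ^ (n + Suc N) / of_nat (n + Suc N)" for n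
  have "T sums (- Ln (1 - z) - (\<Sum>n<Suc N. z ^ n / of_nat n))"
    unfolding T_def using sums_split_initial_segment[OF s, of "Suc N"] by simp
  then have T: "suminf T = - Ln (1 - z) - (\<Sum>n<Suc N. z ^ n / of_nat n)" by (rule sums_unique[symmetric])
  have "norm (suminf T) \<le> (\<Sum>n. r ^ n / real N)"
  proof (rule norm_suminf_le)
    show "summable (\<lambda>n. r ^ n / real N)"
      using r by (intro summable_divide summable_geometric) simp
    fix n
    have "norm (T n) = r ^ (n + Suc N) / real (n + Suc N)"
      unfolding T_def r_def norm_divide norm_power norm_of_nat ..
    also have "\<dots> \<le> r ^ n / real N"
      using assms(1) r by (intro frac_le power_decreasing) auto
    finally show "norm (T n) \<le> r ^ n / real N" .
  qed
  also have "\<dots> = (\<Sum>n. r ^ n) / real N"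
    using r by (intro suminf_divide summable_geometric) simp
  also have "\<dots> = 2"
    using r assms(1) suminf_geometric[of r] z by (simp add: r_def[symmetric])
  finally have "norm (suminf T) \<le> 2" .
  \<comment> \<open>The term \<open>n = 0\<close> is a division by zero, hence 0, so both index
    ranges give the same sum.\<close>
  moreover have "(\<Sum>n<Suc N. z ^ n / of_nat n) = (\<Sum>n=1..N. z ^ n / of_nat n)"
    by (rule sum.mono_neutral_right) auto
  then have "(\<Sum>n=1..N. z ^ n / of_nat n) = - (suminf T + Ln (1 - z))"
    unfolding T by simp
  ultimately show ?thesis
    using norm_triangle_ineq[of "suminf T" "Ln (1 - z)"] by (simp only: norm_minus_cancel)
qed

text \<open>The squared modulus equals
  \<open>(1 - r)\<^sup>2 + 4 * r * (sin (u / 2))\<^sup>2\<close>, and \<open>4 * r\<close> is at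
  least 1. The lower bound is thus independent of \<open>r\<close>.\<close>

lemma norm_one_minus_cis_ge:
  assumes "1 / 2 \<le> r"
  shows "\<bar>sin (u / 2)\<bar> \<le> norm (1 - of_real r * cis u)"
proof (rule power2_le_imp_le)
  have "(norm (1 - of_real r * cis u))\<^sup>2 = (1 - r * cos u)\<^sup>2 + (r * sin u)\<^sup>2"
    by (simp add: cmod_power2)
  also have "\<dots> = (1 - r)\<^sup>2 + 2 * r * (1 - cos u)"
    using sin_cos_squared_add[of u] by algebra
  also have "\<dots> = (1 - r)\<^sup>2 + 4 * r * (sin (u / 2))\<^sup>2"
    using cos_double_sin[of "u / 2"] by simp
  finally have "(norm (1 - of_real r * cis u))\<^sup>2 = (1 - r)\<^sup>2 + 4 * r * (sin (u / 2))\<^sup>2" .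
  moreover have "1 * (sin (u / 2))\<^sup>2 \<le> (4 * r) * (sin (u / 2))\<^sup>2"
    using assms by (intro mult_right_mono) auto
  moreover have "0 \<le> (1 - r)\<^sup>2" by simp
  ultimately show "\<bar>sin (u / 2)\<bar>\<^sup>2 \<le> (norm (1 - of_real r * cis u))\<^sup>2"
    unfolding power2_abs by linarith
qed simp

text \<open>The real part of the logarithm is the log of a modulus between
  \<open>\<bar>sin (u / 2)\<bar>\<close> and 2, which contributes at most 1 beyond the singular
  term. The principal argument contributes at most pi, which is below 4.\<close>

lemma norm_Ln_one_minus_cis_le:
  assumes "1 / 2 \<le> r" "r < 1" and s: "sin (u / 2) \<noteq> 0"
  shows "norm (Ln (1 - of_real r * cis u)) \<le> 5 + ln (1 / \<bar>sin (u / 2)\<bar>)"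
proof -
  define w where "w = 1 - of_real r * cis u"
  have sw: "\<bar>sin (u / 2)\<bar> \<le> norm w"
    unfolding w_def by (rule norm_one_minus_cis_ge) (rule assms)
  have w2: "norm w \<le> 2"
    unfolding w_def using norm_triangle_ineq4[of 1 "of_real r * cis u"] assms by (simp add: norm_mult)
  have "w \<noteq> 0" using sw s by auto
  have "ln \<bar>sin (u / 2)\<bar> \<le> ln (norm w)" by (rule ln_mono) (use s sw in auto)
  moreover have "ln (norm w) \<le> ln 2" by (rule ln_mono) (use w2 \<open>w \<noteq> 0\<close> in auto)
  moreover have "ln \<bar>sin (u / 2)\<bar> \<le> 0" using s by (simp add: abs_sin_le_one)
  moreover have "ln 2 \<le> (1::real)" using ln_le_minus_one[of 2] by simp
  ultimately have "\<bar>ln (norm w)\<bar> \<le> 1 - ln \<bar>sin (u / 2)\<bar>" by linarith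
  moreover have "\<bar>Im (Ln w)\<bar> \<le> 4"
    using mpi_less_Im_Ln[OF \<open>w \<noteq> 0\<close>] Im_Ln_le_pi[OF \<open>w \<noteq> 0\<close>] pi_less_4 by linarith
  moreover have "norm (Ln w) \<le> \<bar>Re (Ln w)\<bar> + \<bar>Im (Ln w)\<bar>" by (rule cmod_le)
  ultimately show ?thesis
    using \<open>w \<noteq> 0\<close> s by (simp add: w_def[symmetric] ln_div)
qed

text \<open>If either number is at most \<open>1 / sqrt s\<close>, the linear term dominates; otherwise
  \<open>ln (1 / s) / 2\<close> is below both logarithms, hence below their geometric mean.\<close>

lemma mult_log_le:
  fixes a b s :: real
  assumes "a \<ge> 0" "b \<ge> 0" "0 < s" "s \<le> 1"
  shows "a * b * ln (1 / s)
    \<le> 2 * (a * sqrt (ln (1 + a))) * (b * sqrt (ln (1 + b))) + 4 * (a + b) * s powr (-3/4)"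
proof -
  define l where "l = ln (1 / s)"
  have l: "l \<ge> 0" using assms by (simp add: l_def)
  have \<Phi>: "a * sqrt (ln (1 + a)) \<ge> 0" "b * sqrt (ln (1 + b)) \<ge> 0" using assms by auto
  show ?thesis
  proof (cases "min a b \<le> s powr (-1/2)")
    case True
    \<comment> \<open>Trading the logarithm for the power -1/4 makes the total exponent -1/2 - 1/4 =
      -3/4, which is still integrable at 0.\<close>
    have "l / 4 = ln (s powr (-1/4))" using assms by (simp add: l_def ln_powr ln_div)
    also have "\<dots> \<le> s powr (-1/4)"
      using ln_le_minus_one[of "s powr (-1/4)"] assms by simp
    finally have l4: "l \<le> 4 * s powr (-1/4)" by simp
    have "a * b = max a b * min a b" by (simp add: max_def min_def)
    also have "\<dots> \<le> (a + b) * s powr (-1/2)" by (rule mult_mono[OF _ True]) (use assms in auto)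
    finally have "a * b * l \<le> ((a + b) * s powr (-1/2)) * (4 * s powr (-1/4))"
      by (rule mult_mono) (use l4 l assms in simp_all)
    also have "\<dots> = 4 * (a + b) * (s powr (-1/2) * s powr (-1/4))" by simp
    also have "\<dots> = 4 * (a + b) * s powr (-3/4)" unfolding powr_add[symmetric] by simp
    finally show ?thesis unfolding l_def using mult_nonneg_nonneg[OF \<Phi>] by linarith
  next
    case False
    have half: "l / 2 \<le> ln (1 + c)" if "s powr (-1/2) < c" for c
    proof -
      have "l / 2 = ln (s powr (-1/2))" using assms by (simp add: l_def ln_powr ln_div)
      also have "\<dots> \<le> ln (1 + c)"
        using that assms by (subst ln_le_cancel_iff) (auto intro: add_pos_pos less_trans[of 0 "s powr (-1/2)"])
      finally show ?thesis .
    qed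
    have "l / 2 = sqrt (l / 2) * sqrt (l / 2)" using l by simp
    also have "\<dots> \<le> sqrt (ln (1 + a)) * sqrt (ln (1 + b))"
      using False half[of a] half[of b] l assms by (intro mult_mono real_sqrt_le_mono) auto
    finally have "(a * b) * (l / 2) \<le> (a * b) * (sqrt (ln (1 + a)) * sqrt (ln (1 + b)))"
      using assms by (intro mult_left_mono) auto
    moreover have "4 * (a + b) * s powr (-3/4) \<ge> 0" using assms by simp
    ultimately show ?thesis unfolding l_def by (simp add: mult_ac)
  qed
qed

text \<open>The function \<open>sin t - t * cos t\<close> has derivative \<open>t * sin t\<close>,
  so \<open>t * cos t \<le> sin t\<close>. Using this at \<open>t = v / 2\<close> in the
  double-angle formula gives \<open>sin v \<ge> v / 2 * (1 + cos v)\<close>.\<close>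

lemma half_le_sin:
  assumes "0 \<le> v" "v \<le> pi / 2"
  shows "v / 2 \<le> sin v"
proof -
  have t: "t * cos t \<le> sin t" if "0 \<le> t" "t \<le> pi / 2" for t
  proof -
    have "(\<lambda>t. sin t - t * cos t) 0 \<le> (\<lambda>t. sin t - t * cos t) t"
    proof (rule DERIV_nonneg_imp_nondecreasing[OF that(1)])
      fix x assume "0 \<le> x" "x \<le> t"
      then have "0 \<le> x * sin x" using that by (intro mult_nonneg_nonneg sin_ge_zero) auto
      moreover have "((\<lambda>t. sin t - t * cos t) has_real_derivative x * sin x) (at x)"
        by (auto intro!: derivative_eq_intros)
      ultimately show "\<exists>y. ((\<lambda>t. sin t - t * cos t) has_real_derivative y) (at x) \<and> 0 \<le> y" by blast
    qed
    then show ?thesis by simp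
  qed
  have "v / 2 * 1 \<le> v / 2 * (1 + cos v)"
    using assms by (intro mult_left_mono) (auto intro: cos_ge_zero)
  also have "\<dots> = 2 * (v / 2 * cos (v / 2)) * cos (v / 2)"
    using cos_double_cos[of "v / 2"] by (simp add: power2_eq_square)
  also have "\<dots> \<le> 2 * sin (v / 2) * cos (v / 2)"
    using t[of "v / 2"] assms by (intro mult_right_mono mult_left_mono) (auto intro: cos_ge_zero)
  also have "\<dots> = sin v" using sin_double[of "v / 2"] by simp
  finally show ?thesis by simp
qed

text \<open>On the closed interval from -2 pi to 2 pi the sine vanishes exactly at 0 and at both
  endpoints. It is at least a quarter of the distance to the nearest zero; adding the powers for all
  three zeros covers every case.\<close>

lemma sin_half_powr_le:
  assumes "u \<noteq> 0" "\<bar>u\<bar> < 2 * pi"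
  shows "\<bar>sin (u / 2)\<bar> powr (-3/4)
    \<le> 4 * (\<bar>u\<bar> powr (-3/4) + \<bar>u + 2 * pi\<bar> powr (-3/4) + \<bar>u - 2 * pi\<bar> powr (-3/4))"
proof -
  define v where "v = \<bar>u\<bar> / 2"
  have v: "0 < v" "v < pi" using assms by (auto simp: v_def)
  have sv: "\<bar>sin (u / 2)\<bar> = sin v"
    using v sin_gt_zero[of v] by (cases "u \<ge> 0") (auto simp: v_def)
  have le: "sin v powr (-3/4) \<le> 4 * d powr (-3/4)" if "0 < d" "d / 4 \<le> sin v" for d
  proof -
    have "sin v powr (-3/4) \<le> (d / 4) powr (-3/4)"
      using that by (intro powr_mono2') auto
    also have "\<dots> = 4 powr (3/4) * d powr (-3/4)"
      using that by (simp add: powr_divide powr_minus field_simps)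
    also have "\<dots> \<le> 4 powr 1 * d powr (-3/4)"
      by (intro mult_right_mono powr_mono) auto
    finally show ?thesis by simp
  qed
  define p q q' where "p = \<bar>u\<bar> powr (-3/4)" and "q = \<bar>u + 2 * pi\<bar> powr (-3/4)"
    and "q' = \<bar>u - 2 * pi\<bar> powr (-3/4)"
  note pq = this
  have nonneg: "0 \<le> p" "0 \<le> q" "0 \<le> q'" by (simp_all add: pq)
  show ?thesis
  proof (cases "v \<le> pi / 2")
    case True
    have "sin v powr (-3/4) \<le> 4 * \<bar>u\<bar> powr (-3/4)"
      using half_le_sin[of v] True v by (intro le) (simp_all add: v_def)
    then show ?thesis
      unfolding sv pq[symmetric] by (rule order.trans) (use nonneg in simp)
  next
    \<comment> \<open>Past pi / 2 the sine is compared at the reflected angle \<open>pi - v\<close>,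
      which measures the distance of \<open>u\<close> to one of the endpoints.\<close>
    case False
    have "(2 * pi - \<bar>u\<bar>) / 4 = (pi - v) / 2" by (simp add: v_def field_simps)
    also have "\<dots> \<le> sin v" using half_le_sin[of "pi - v"] False v by simp
    finally have *: "(2 * pi - \<bar>u\<bar>) / 4 \<le> sin v" .
    have **: "sin v powr (-3/4) \<le> 4 * (2 * pi - \<bar>u\<bar>) powr (-3/4)"
      by (rule le) (use * assms in auto)
    have "2 * pi - \<bar>u\<bar> = \<bar>u + 2 * pi\<bar> \<or> 2 * pi - \<bar>u\<bar> = \<bar>u - 2 * pi\<bar>"
      using assms by auto
    then show ?thesis
    proof
      assume eq: "2 * pi - \<bar>u\<bar> = \<bar>u + 2 * pi\<bar>"
      show ?thesis
        unfolding sv pq[symmetric] by (rule order.trans[OF **[unfolded eq pq[symmetric]]]) (use nonneg in simp)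
    next
      assume eq: "2 * pi - \<bar>u\<bar> = \<bar>u - 2 * pi\<bar>"
      show ?thesis
        unfolding sv pq[symmetric] by (rule order.trans[OF **[unfolded eq pq[symmetric]]]) (use nonneg in simp)
    qed
  qed
qed

section \<open>From weighted coefficient sums to the energy integral\<close>

lemma sigma_finite_torus: "sigma_finite_measure torus"
  using finite_measure_torus by (rule finite_measure.axioms(1))

text \<open>In \<open>F n * cnj (F n)\<close> one factor is expanded as an integral in
  \<open>x\<close> and the other in \<open>y\<close>. Pulling the finite sum inside produces a
  convolution kernel, and the norms are then moved inside the two integrals one at a time.\<close>

lemma weighted_sum_fourier_le:
  fixes f :: "real \<Rightarrow> complex" and c :: "nat \<Rightarrow> real"
  assumes f: "integrable torus f" and "finite I"
  defines "F \<equiv> \<lambda>n. LINT \<theta>|torus. f \<theta> * cis (- (real n * \<theta>))"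
  shows "ennreal (\<Sum>n\<in>I. c n * (cmod (F n))\<^sup>2)
    \<le> (\<integral>\<^sup>+x. \<integral>\<^sup>+y. ennreal (cmod (f x) * cmod (f y)
          * cmod (\<Sum>n\<in>I. of_real (c n) * cis (- (real n * (x - y))))) \<partial>torus \<partial>torus)"
proof -
  have cisf: "integrable torus (\<lambda>x. f x * cis (t * x))" for t
  proof (rule Bochner_Integration.integrable_bound[OF f])
    have "(\<lambda>x. cis (t * x)) \<in> borel_measurable torus"
      by (intro torus_measurable_borel borel_measurable_continuous_onI continuous_intros)
    then show "(\<lambda>x. f x * cis (t * x)) \<in> borel_measurable torus"
      using f by (intro borel_measurable_times) auto
  qed (simp add: norm_mult)
  have intF: "integrable torus (\<lambda>x. f x * cis (- (real n * x)))" for n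
    using cisf[of "- real n"] by simp
  have cnjF: "cnj (F n) = (LINT y|torus. cnj (f y) * cis (real n * y))" for n
    unfolding F_def by (subst Bochner_Integration.integral_cnj[symmetric]) (simp add: cis_cnj)
  have intcnj: "integrable torus (\<lambda>y. cnj (f y) * cis (real n * y))" for n
    using integrable_cnj[OF intF[of n]] by (simp add: cis_cnj)
  define G where "G x = (\<Sum>n\<in>I. of_real (c n) * (f x * cis (- (real n * x))) * cnj (F n))" for x
  have "complex_of_real (\<Sum>n\<in>I. c n * (cmod (F n))\<^sup>2) = (\<Sum>n\<in>I. of_real (c n) * F n * cnj (F n))"
    by (simp only: of_real_sum of_real_mult complex_norm_square mult.assoc)
  also have "\<dots> = (LINT x|torus. G x)"
    unfolding G_def by (subst Bochner_Integration.integral_sum) (auto intro!: intF simp: F_def)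
  finally have eq: "complex_of_real (\<Sum>n\<in>I. c n * (cmod (F n))\<^sup>2) = (LINT x|torus. G x)" .
  have G: "G x = (LINT y|torus. f x * cnj (f y)
      * (\<Sum>n\<in>I. of_real (c n) * cis (- (real n * (x - y)))))" for x
  proof -
    have "G x = (\<Sum>n\<in>I. (LINT y|torus. (of_real (c n) * (f x * cis (- (real n * x))))
        * (cnj (f y) * cis (real n * y))))"
      unfolding G_def cnjF by simp
    also have "\<dots> = (LINT y|torus. (\<Sum>n\<in>I. (of_real (c n) * (f x * cis (- (real n * x))))
        * (cnj (f y) * cis (real n * y))))"
      by (rule Bochner_Integration.integral_sum[symmetric]) (intro integrable_mult_right intcnj)
    also have "\<dots> = (LINT y|torus. f x * cnj (f y)
      * (\<Sum>n\<in>I. of_real (c n) * cis (- (real n * (x - y)))))"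
    proof (intro Bochner_Integration.integral_cong refl)
      fix y
      have "(of_real (c n) * (f x * cis (- (real n * x)))) * (cnj (f y) * cis (real n * y))
          = f x * cnj (f y) * (of_real (c n) * cis (- (real n * (x - y))))" for n
      proof -
        have "cis (- (real n * (x - y))) = cis (- (real n * x)) * cis (real n * y)"
          by (simp add: cis_mult right_diff_distrib)
        then show ?thesis by (simp add: mult_ac)
      qed
      then show "(\<Sum>n\<in>I. (of_real (c n) * (f x * cis (- (real n * x)))) * (cnj (f y) * cis (real n * y)))
          = f x * cnj (f y) * (\<Sum>n\<in>I. of_real (c n) * cis (- (real n * (x - y))))"
        by (simp only: sum_distrib_left)
    qed
    finally show ?thesis .
  qed
  \<comment> \<open>For non-integrable \<open>h\<close> the Bochner integral is 0, so the inequality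
    holds without any integrability assumption.\<close>
  have norm_le: "ennreal (norm (LINT x|torus. h x)) \<le> (\<integral>\<^sup>+x. ennreal (norm (h x)) \<partial>torus)"
    for h :: "real \<Rightarrow> complex"
    by (cases "integrable torus h") (auto simp: integral_norm_bound_ennreal not_integrable_integral_eq)
  have "ennreal (\<Sum>n\<in>I. c n * (cmod (F n))\<^sup>2) \<le> ennreal (norm (LINT x|torus. G x))"
    unfolding eq[symmetric] norm_of_real by (intro ennreal_leI) simp
  also have "\<dots> \<le> (\<integral>\<^sup>+x. ennreal (norm (G x)) \<partial>torus)" by (rule norm_le)
  also have "\<dots> \<le> (\<integral>\<^sup>+x. \<integral>\<^sup>+y. ennreal (norm (f x * cnj (f y)
      * (\<Sum>n\<in>I. of_real (c n) * cis (- (real n * (x - y)))))) \<partial>torus \<partial>torus)"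
    unfolding G by (intro nn_integral_mono norm_le)
  finally show ?thesis by (simp only: norm_mult complex_mod_cnj)
qed

text \<open>The 7 adds the tail bound 2 and the constant 5 of the logarithm bound; the 16 multiplies
  the 4 of \<open>mult_log_le\<close> by the 4 of \<open>sin_half_powr_le\<close>.\<close>

lemma kernel_pointwise_le:
  assumes "N > 0" "x \<in> {0..<2 * pi}" "y \<in> {0..<2 * pi}" "x \<noteq> y" "a \<ge> 0" "b \<ge> 0"
  defines "r \<equiv> 1 - 1 / (2 * real N)" and "u \<equiv> x - y"
  shows "a * b * cmod (\<Sum>n=1..N. of_real (r ^ n / real n) * cis (- (real n * u)))
    \<le> 7 * a * b + 2 * (a * sqrt (ln (1 + a))) * (b * sqrt (ln (1 + b)))
      + 16 * (a + b) * (\<bar>u\<bar> powr (-3/4) + \<bar>u + 2 * pi\<bar> powr (-3/4) + \<bar>u - 2 * pi\<bar> powr (-3/4))"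
proof -
  define s where "s = \<bar>sin (u / 2)\<bar>"
  have u: "u \<noteq> 0" "\<bar>u\<bar> < 2 * pi" using assms by (auto simp: u_def)
  have r: "1 / 2 \<le> r" "r < 1" using assms(1) by (auto simp: r_def field_simps)
  \<comment> \<open>Here \<open>u / 2\<close> lies strictly between - pi and pi and is
    nonzero.\<close>
  have "sin (u / 2) \<noteq> 0"
    using sin_eq_0_pi[of "u / 2"] u by (auto simp: abs_less_iff)
  then have s: "0 < s" "s \<le> 1" by (auto simp: s_def)
  define z where "z = of_real r * cis (- u)"
  have "norm z = r" using r by (simp add: z_def norm_mult)
  then have "norm z = 1 - 1 / (2 * real N)" unfolding r_def .
  then have "norm (\<Sum>n=1..N. z ^ n / of_nat n) \<le> 2 + norm (Ln (1 - z))"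
    by (rule norm_partial_sum_log_le[OF assms(1)])
  also have "norm (Ln (1 - z)) \<le> 5 + ln (1 / s)"
    using norm_Ln_one_minus_cis_le[OF r, of "- u"] \<open>sin (u / 2) \<noteq> 0\<close> by (simp add: z_def s_def)
  also have "(\<Sum>n=1..N. z ^ n / of_nat n) = (\<Sum>n=1..N. of_real (r ^ n / real n) * cis (- (real n * u)))"
    by (simp add: z_def power_mult_distrib Complex.DeMoivre)
  finally have "a * b * cmod (\<Sum>n=1..N. of_real (r ^ n / real n) * cis (- (real n * u)))
      \<le> a * b * (2 + (5 + ln (1 / s)))"
    using assms by (intro mult_left_mono) auto
  also have "\<dots> = 7 * a * b + a * b * ln (1 / s)" by (simp add: algebra_simps)
  also have "a * b * ln (1 / s)
    \<le> 2 * (a * sqrt (ln (1 + a))) * (b * sqrt (ln (1 + b))) + 4 * (a + b) * s powr (-3/4)"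
    by (rule mult_log_le) (use assms s in auto)
  also have "4 * (a + b) * s powr (-3/4) \<le> 4 * (a + b) * (4 * (\<bar>u\<bar> powr (-3/4)
      + \<bar>u + 2 * pi\<bar> powr (-3/4) + \<bar>u - 2 * pi\<bar> powr (-3/4)))"
    unfolding s_def using assms u by (intro mult_left_mono sin_half_powr_le) auto
  also have "\<dots> = 16 * (a + b) * (\<bar>u\<bar> powr (-3/4)
      + \<bar>u + 2 * pi\<bar> powr (-3/4) + \<bar>u - 2 * pi\<bar> powr (-3/4))"
    by (simp add: algebra_simps)
  finally show ?thesis by (simp only: add.assoc)
qed

text \<open>Enlarging the domain to the whole line makes affine substitutions available.\<close>

lemma nn_integral_torus_le_lborel:
  assumes "g \<in> borel_measurable borel"
  shows "(\<integral>\<^sup>+x. g x \<partial>torus) \<le> (\<integral>\<^sup>+x. g x \<partial>lborel)"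
proof -
  have "(\<integral>\<^sup>+x. g x \<partial>torus) = (\<integral>\<^sup>+x. g x * indicator {0..<2*pi} x \<partial>lebesgue)"
    unfolding torus_def by (rule nn_integral_restrict_space) simp
  also have "\<dots> \<le> (\<integral>\<^sup>+x. g x \<partial>lebesgue)"
    by (intro nn_integral_mono) (auto simp: indicator_def)
  finally show ?thesis by (simp add: nn_integral_completion)
qed

text \<open>The exponent exceeds -1, so the singularity is integrable uniformly in its position. The
  range 4 pi accommodates a point of the circle shifted by 2 pi, and distances to the circle are
  then at most 6 pi. The bound \<open>D\<close> is two copies of a one-sided integral, one for each
  sign of \<open>w - y\<close>.\<close>

lemma nn_integral_torus_powr_bounded:
  obtains D :: ennreal where "D < \<infinity>"
    "\<And>w. \<bar>w\<bar> \<le> 4 * pi \<Longrightarrow> (\<integral>\<^sup>+y. ennreal (\<bar>w - y\<bar> powr (-3/4)) \<partial>torus) \<le> D"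
proof -
  define h where "h t = ennreal (t powr (-3/4)) * indicator {0..6*pi} t" for t :: real
  have [measurable]: "h \<in> borel_measurable borel" unfolding h_def by measurable
  have "((\<lambda>x. x powr (-3/4)) has_integral ((6*pi) powr (-3/4 + 1) / (-3/4 + 1))) {0..6*pi}"
    by (rule has_integral_powr_from_0) auto
  then have h: "(\<integral>\<^sup>+t. h t \<partial>lborel) = ennreal ((6*pi) powr (-3/4 + 1) / (-3/4 + 1))"
    using nn_integral_has_integral_lebesgue[of "{0..6*pi}" "\<lambda>x. x powr (-3/4)"]
    by (simp add: h_def nn_integral_completion mult.commute ennreal_mult' ennreal_indicator)
  show ?thesis
  proof (rule that[of "(\<integral>\<^sup>+t. h t \<partial>lborel) + (\<integral>\<^sup>+t. h t \<partial>lborel)"])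
    show "(\<integral>\<^sup>+t. h t \<partial>lborel) + (\<integral>\<^sup>+t. h t \<partial>lborel) < \<infinity>"
      unfolding h by (simp flip: ennreal_plus)
    fix w :: real assume w: "\<bar>w\<bar> \<le> 4 * pi"
    have "(\<integral>\<^sup>+y. ennreal (\<bar>w - y\<bar> powr (-3/4)) \<partial>torus) \<le> (\<integral>\<^sup>+y. h (w + (-1) * y) + h (- w + 1 * y) \<partial>torus)"
    proof (intro nn_integral_mono)
      fix y assume "y \<in> space torus"
      then have "\<bar>w - y\<bar> \<le> 6 * pi" using w by auto
      then show "ennreal (\<bar>w - y\<bar> powr (-3/4)) \<le> h (w + (-1) * y) + h (- w + 1 * y)"
        by (cases "w \<le> y") (auto simp: h_def abs_if)
    qed
    also have "\<dots> \<le> (\<integral>\<^sup>+y. h (w + (-1) * y) + h (- w + 1 * y) \<partial>lborel)"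
      by (rule nn_integral_torus_le_lborel) measurable
    also have "\<dots> = (\<integral>\<^sup>+y. h (w + (-1) * y) \<partial>lborel) + (\<integral>\<^sup>+y. h (- w + 1 * y) \<partial>lborel)"
      by (rule nn_integral_add) measurable
    also have "(\<integral>\<^sup>+y. h (w + (-1) * y) \<partial>lborel) = (\<integral>\<^sup>+t. h t \<partial>lborel)"
      by (subst nn_integral_real_affine[of h "-1" w]) auto
    also have "(\<integral>\<^sup>+y. h (- w + 1 * y) \<partial>lborel) = (\<integral>\<^sup>+t. h t \<partial>lborel)"
      by (subst nn_integral_real_affine[of h 1 "- w"]) auto
    finally show "(\<integral>\<^sup>+y. ennreal (\<bar>w - y\<bar> powr (-3/4)) \<partial>torus)
        \<le> (\<integral>\<^sup>+t. h t \<partial>lborel) + (\<integral>\<^sup>+t. h t \<partial>lborel)" .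
  qed
qed

text \<open>Above 1 the logarithmic factor is at least \<open>sqrt (ln 2)\<close>, which exceeds
  1/2; below 1 the constant suffices.\<close>

lemma le_one_plus_two_mult_sqrt_ln:
  assumes "a \<ge> (0::real)"
  shows "a \<le> 1 + 2 * (a * sqrt (ln (1 + a)))"
proof (cases "a \<le> 1")
  case True
  have "0 \<le> a * sqrt (ln (1 + a))" using assms by simp
  then show ?thesis using True by linarith
next
  case False
  have "(1/2)\<^sup>2 \<le> ln (2::real)" using ln_le_minus_one[of "1/2"] by (simp add: ln_div power2_eq_square)
  also have "\<dots> \<le> ln (1 + a)" using False by (intro ln_mono) auto
  finally have "1 / 2 \<le> sqrt (ln (1 + a))" by (rule real_le_rsqrt)
  then have "a * (1 / 2) \<le> a * sqrt (ln (1 + a))" using assms by (intro mult_left_mono)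
  then show ?thesis by simp
qed

text \<open>On a space of finite mass the additive constant in the preceding bound is harmless.
  Hence \<open>f\<close> is integrable and its Fourier coefficients are genuine integrals.\<close>

lemma nn_integral_norm_L_log_half_L:
  assumes "f \<in> L_log_half_L"
  shows "(\<integral>\<^sup>+x. ennreal (cmod (f x)) \<partial>torus) < \<infinity>"
proof -
  have [measurable]: "f \<in> borel_measurable torus"
    and Q: "(\<integral>\<^sup>+x. ennreal (cmod (f x) * sqrt (ln (1 + cmod (f x)))) \<partial>torus) < \<infinity>"
    using assms by (auto simp: L_log_half_L_def)
  have "(\<integral>\<^sup>+x. ennreal (cmod (f x)) \<partial>torus)
      \<le> (\<integral>\<^sup>+x. 1 + 2 * ennreal (cmod (f x) * sqrt (ln (1 + cmod (f x)))) \<partial>torus)"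
  proof (intro nn_integral_mono)
    fix x
    have "ennreal (cmod (f x)) \<le> ennreal (1 + 2 * (cmod (f x) * sqrt (ln (1 + cmod (f x)))))"
      by (intro ennreal_leI le_one_plus_two_mult_sqrt_ln) simp
    also have "\<dots> = 1 + 2 * ennreal (cmod (f x) * sqrt (ln (1 + cmod (f x))))"
      by (subst ennreal_plus) (simp_all add: ennreal_mult')
    finally show "ennreal (cmod (f x)) \<le> 1 + 2 * ennreal (cmod (f x) * sqrt (ln (1 + cmod (f x))))" .
  qed
  also have "\<dots> = emeasure torus (space torus)
      + 2 * (\<integral>\<^sup>+x. ennreal (cmod (f x) * sqrt (ln (1 + cmod (f x)))) \<partial>torus)"
    by (subst nn_integral_add) (simp_all add: nn_integral_cmult)
  also have "\<dots> < \<infinity>"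
    using Q unfolding emeasure_torus by (simp add: ennreal_mult_less_top)
  finally show ?thesis .
qed

text \<open>This discards the diagonal, which \<open>kernel_pointwise_le\<close> excludes.\<close>

lemma AE_torus_neq: "AE y in torus. y \<noteq> x"
proof -
  have "AE y in lebesgue. y \<noteq> x"
    using AE_lborel_singleton[of x] by (rule AE_completion)
  then show ?thesis unfolding torus_def
    by (subst AE_restrict_space_iff) auto
qed

text \<open>Integrating \<open>kernel_pointwise_le\<close> in both variables gives multiples of
  \<open>W * W\<close>, \<open>Q * Q\<close> and \<open>D * W\<close>, all finite and independent of
  \<open>N\<close>. The damping \<open>r ^ n\<close> is removed only at the end.\<close>

lemma fourier_coeff_square_partial_sums_bounded:
  assumes "f \<in> L_log_half_L"
  obtains K where "\<And>N. (\<Sum>n=1..N. (cmod (fourier_coeff f (int n)))\<^sup>2 / real n) \<le> K"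
proof -
  interpret sigma_finite_measure torus by (rule sigma_finite_torus)
  interpret pair_sigma_finite torus torus ..
  have fm [measurable]: "f \<in> borel_measurable torus"
    and Qfin: "(\<integral>\<^sup>+x. ennreal (cmod (f x) * sqrt (ln (1 + cmod (f x)))) \<partial>torus) < \<infinity>"
    using assms by (auto simp: L_log_half_L_def)
  have id_m [measurable]: "(\<lambda>x. x) \<in> borel_measurable torus"
    by (rule torus_measurable_borel) simp
  have fst_m [measurable]: "fst \<in> borel_measurable (torus \<Otimes>\<^sub>M torus)"
    using measurable_compose[OF measurable_fst id_m] by simp
  have snd_m [measurable]: "snd \<in> borel_measurable (torus \<Otimes>\<^sub>M torus)"
    using measurable_compose[OF measurable_snd id_m] by simp
  define w where "w x = cmod (f x)" for x
  define \<Phi> where "\<Phi> x = w x * sqrt (ln (1 + w x))" for x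
  have w0: "0 \<le> w x" and \<Phi>0: "0 \<le> \<Phi> x" for x by (simp_all add: w_def \<Phi>_def)
  have [measurable]: "w \<in> borel_measurable torus" unfolding w_def by measurable
  have [measurable]: "\<Phi> \<in> borel_measurable torus" unfolding \<Phi>_def by measurable
  define W Q where "W = (\<integral>\<^sup>+x. ennreal (w x) \<partial>torus)" and "Q = (\<integral>\<^sup>+x. ennreal (\<Phi> x) \<partial>torus)"
  have W: "W < \<infinity>" unfolding W_def w_def by (rule nn_integral_norm_L_log_half_L) (rule assms)
  have Q: "Q < \<infinity>" unfolding Q_def \<Phi>_def w_def by (rule Qfin)
  have f_int: "integrable torus f"
    using W by (intro integrableI_bounded) (auto simp: W_def w_def)
  define k where "k x y = ennreal (\<bar>x - y\<bar> powr (-3/4)) + ennreal (\<bar>x - y + 2*pi\<bar> powr (-3/4))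
      + ennreal (\<bar>x - y - 2*pi\<bar> powr (-3/4))" for x y
  have k_m [measurable]: "(\<lambda>(x, y). k x y) \<in> borel_measurable (torus \<Otimes>\<^sub>M torus)"
    unfolding k_def case_prod_beta by measurable
  have k_m2 [measurable]: "k x \<in> borel_measurable torus" for x unfolding k_def by measurable
  \<comment> \<open>Exchanging the variables swaps the two shifted singularities, so the bound on
    the integral of \<open>k\<close> in \<open>y\<close> also serves for \<open>x\<close>.\<close>
  have k_sym: "k x y = k y x" for x y
  proof -
    have "\<bar>x - y\<bar> = \<bar>y - x\<bar>" "\<bar>x - y + 2*pi\<bar> = \<bar>y - x - 2*pi\<bar>" "\<bar>x - y - 2*pi\<bar> = \<bar>y - x + 2*pi\<bar>"
      by arith+
    then show ?thesis unfolding k_def by (simp only: add_ac)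
  qed
  obtain D :: ennreal where D: "D < \<infinity>"
    "\<And>w. \<bar>w\<bar> \<le> 4 * pi \<Longrightarrow> (\<integral>\<^sup>+y. ennreal (\<bar>w - y\<bar> powr (-3/4)) \<partial>torus) \<le> D"
    using nn_integral_torus_powr_bounded by blast
  have k_int: "(\<integral>\<^sup>+y. k x y \<partial>torus) \<le> 3 * D" if x: "x \<in> space torus" for x
  proof -
    have eq: "x - y + 2*pi = (x + 2*pi) - y" "x - y - 2*pi = (x - 2*pi) - y" for y by auto
    have "(\<integral>\<^sup>+y. k x y \<partial>torus) = (\<integral>\<^sup>+y. ennreal (\<bar>x - y\<bar> powr (-3/4)) \<partial>torus)
        + (\<integral>\<^sup>+y. ennreal (\<bar>(x + 2*pi) - y\<bar> powr (-3/4)) \<partial>torus)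
        + (\<integral>\<^sup>+y. ennreal (\<bar>(x - 2*pi) - y\<bar> powr (-3/4)) \<partial>torus)"
      unfolding k_def eq by (simp add: nn_integral_add)
    also have "\<dots> \<le> D + D + D"
      using x by (intro add_mono D(2)) auto
    also have "\<dots> = (1 + 1 + 1) * D" by (simp only: distrib_right mult_1)
    also have "\<dots> = 3 * D" by simp
    finally show ?thesis .
  qed
  \<comment> \<open>The weight sits on the inner variable, so the order of integration is exchanged
    before the uniform bound on the kernel is used.\<close>
  have swap: "(\<integral>\<^sup>+x. \<integral>\<^sup>+y. ennreal (w y) * k x y \<partial>torus \<partial>torus) \<le> W * (3 * D)"
  proof -
    have "(\<integral>\<^sup>+x. \<integral>\<^sup>+y. ennreal (w y) * k x y \<partial>torus \<partial>torus)
        = (\<integral>\<^sup>+y. \<integral>\<^sup>+x. ennreal (w y) * k x y \<partial>torus \<partial>torus)"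
      by (rule Fubini'[symmetric]) measurable
    also have "\<dots> = (\<integral>\<^sup>+y. ennreal (w y) * (\<integral>\<^sup>+x. k y x \<partial>torus) \<partial>torus)"
    proof (rule nn_integral_cong)
      fix y
      have "(\<integral>\<^sup>+x. ennreal (w y) * k x y \<partial>torus) = (\<integral>\<^sup>+x. ennreal (w y) * k y x \<partial>torus)"
        by (simp only: k_sym[of _ y])
      then show "(\<integral>\<^sup>+x. ennreal (w y) * k x y \<partial>torus) = ennreal (w y) * (\<integral>\<^sup>+x. k y x \<partial>torus)"
        by (simp add: nn_integral_cmult)
    qed
    also have "\<dots> \<le> (\<integral>\<^sup>+y. ennreal (w y) * (3 * D) \<partial>torus)"
      by (intro nn_integral_mono mult_left_mono k_int) auto
    also have "\<dots> = W * (3 * D)" by (simp add: nn_integral_multc W_def)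
    finally show ?thesis .
  qed
  define E where "E = 7 * W * W + 2 * Q * Q + 16 * (3 * D * W + 3 * D * W)"
  have E: "E < \<infinity>" unfolding E_def using W Q D(1) by (simp add: ennreal_mult_less_top)
  have main: "(\<Sum>n=1..N. (1 - 1 / (2 * real N)) ^ n / real n
      * (cmod (LINT \<theta>|torus. f \<theta> * cis (- (real n * \<theta>))))\<^sup>2) \<le> enn2real E" if N: "N > 0" for N
  proof -
    let ?c = "\<lambda>n. (1 - 1 / (2 * real N)) ^ n / real n"
    have pointwise: "AE y in torus. ennreal (w x * w y
          * cmod (\<Sum>n=1..N. of_real (?c n) * cis (- (real n * (x - y)))))
        \<le> 7 * ennreal (w x) * ennreal (w y) + 2 * ennreal (\<Phi> x) * ennreal (\<Phi> y)
          + 16 * (ennreal (w x) * k x y + ennreal (w y) * k x y)"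
      if x: "x \<in> space torus" for x
      using AE_torus_neq[of x] AE_space
    proof eventually_elim
      case (elim y)
      have "w x * w y * cmod (\<Sum>n=1..N. of_real (?c n) * cis (- (real n * (x - y))))
          \<le> 7 * w x * w y + 2 * \<Phi> x * \<Phi> y + 16 * (w x + w y) * (\<bar>x - y\<bar> powr (-3/4)
             + \<bar>x - y + 2 * pi\<bar> powr (-3/4) + \<bar>x - y - 2 * pi\<bar> powr (-3/4))"
        unfolding \<Phi>_def by (rule kernel_pointwise_le) (use N x elim w0 in auto)
      from ennreal_leI[OF this] show ?case
        using w0 \<Phi>0
        by (simp add: ennreal_mult ennreal_plus k_def distrib_left distrib_right mult_ac add_ac)
    qed
    have "ennreal (\<Sum>n=1..N. ?c n * (cmod (LINT \<theta>|torus. f \<theta> * cis (- (real n * \<theta>))))\<^sup>2)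
      \<le> (\<integral>\<^sup>+x. \<integral>\<^sup>+y. ennreal (w x * w y
          * cmod (\<Sum>n=1..N. of_real (?c n) * cis (- (real n * (x - y))))) \<partial>torus \<partial>torus)"
      unfolding w_def by (rule weighted_sum_fourier_le[OF f_int]) simp
    also have "\<dots> \<le> (\<integral>\<^sup>+x. \<integral>\<^sup>+y. 7 * ennreal (w x) * ennreal (w y) + 2 * ennreal (\<Phi> x) * ennreal (\<Phi> y)
          + 16 * (ennreal (w x) * k x y + ennreal (w y) * k x y) \<partial>torus \<partial>torus)"
      by (intro nn_integral_mono nn_integral_mono_AE pointwise)
    also have "\<dots> = (\<integral>\<^sup>+x. 7 * ennreal (w x) * W + 2 * ennreal (\<Phi> x) * Q
          + 16 * (ennreal (w x) * (\<integral>\<^sup>+y. k x y \<partial>torus) + (\<integral>\<^sup>+y. ennreal (w y) * k x y \<partial>torus)) \<partial>torus)"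
      by (simp add: nn_integral_add nn_integral_cmult W_def Q_def)
    also have "\<dots> \<le> (\<integral>\<^sup>+x. 7 * ennreal (w x) * W + 2 * ennreal (\<Phi> x) * Q
          + 16 * (ennreal (w x) * (3 * D) + (\<integral>\<^sup>+y. ennreal (w y) * k x y \<partial>torus)) \<partial>torus)"
      by (intro nn_integral_mono add_mono mult_left_mono k_int) auto
    also have "\<dots> = 7 * W * W + 2 * Q * Q
        + 16 * (W * (3 * D) + (\<integral>\<^sup>+x. \<integral>\<^sup>+y. ennreal (w y) * k x y \<partial>torus \<partial>torus))"
      by (simp add: nn_integral_add nn_integral_cmult nn_integral_multc W_def Q_def)
    also have "\<dots> \<le> E"
      unfolding E_def using swap by (intro add_mono mult_left_mono) (auto simp: mult_ac)
    also have "E = ennreal (enn2real E)" using E by simp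
    finally show ?thesis by (subst (asm) ennreal_le_iff) simp_all
  qed
  show ?thesis
  proof (rule that)
    fix N
    show "(\<Sum>n=1..N. (cmod (fourier_coeff f (int n)))\<^sup>2 / real n) \<le> 2 * enn2real E"
    proof (cases "N > 0")
      case True
      have "(cmod (fourier_coeff f (int n)))\<^sup>2 / real n \<le> 2 * ((1 - 1 / (2 * real N)) ^ n / real n
          * (cmod (LINT \<theta>|torus. f \<theta> * cis (- (real n * \<theta>))))\<^sup>2)" if n: "n \<in> {1..N}" for n
      proof -
        let ?F = "LINT \<theta>|torus. f \<theta> * cis (- (real n * \<theta>))"
        \<comment> \<open>Bernoulli's inequality keeps the damping factor at least 1/2 for all
          \<open>n \<le> N\<close>, so removing it costs a factor 2.\<close>
        have "1 / 2 \<le> 1 - real n / (2 * real N)" using n by (simp add: field_simps)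
        also have "\<dots> \<le> (1 - 1 / (2 * real N)) ^ n"
          using Bernoulli_inequality[of "- 1 / (2 * real N)" n] n by (simp add: field_simps)
        finally have 1: "1 \<le> 2 * (1 - 1 / (2 * real N)) ^ n" by simp
        \<comment> \<open>The normalising factor \<open>1 / (2 * pi)\<close> is simply estimated by
          1.\<close>
        have "cmod (fourier_coeff f (int n)) = cmod ?F / (2 * pi)"
          by (simp add: fourier_coeff_def)
        also have "\<dots> \<le> cmod ?F / 1"
          using pi_gt3 by (intro divide_left_mono) auto
        finally have "(cmod (fourier_coeff f (int n)))\<^sup>2 \<le> 1 * (cmod ?F)\<^sup>2" by (simp add: power_mono)
        also have "\<dots> \<le> 2 * (1 - 1 / (2 * real N)) ^ n * (cmod ?F)\<^sup>2"
          using 1 by (rule mult_right_mono) simp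
        finally show ?thesis using n by (simp add: divide_right_mono)
      qed
      then have "(\<Sum>n=1..N. (cmod (fourier_coeff f (int n)))\<^sup>2 / real n)
          \<le> 2 * (\<Sum>n=1..N. (1 - 1 / (2 * real N)) ^ n / real n
          * (cmod (LINT \<theta>|torus. f \<theta> * cis (- (real n * \<theta>))))\<^sup>2)"
        unfolding sum_distrib_left by (rule sum_mono)
      then show ?thesis using main[OF True] by linarith
    qed simp
  qed
qed

section \<open>Negative frequencies and the two conclusions\<close>

lemma L_log_half_L_cnj:
  assumes "f \<in> L_log_half_L"
  shows "(\<lambda>x. cnj (f x)) \<in> L_log_half_L"
proof -
  have "(\<lambda>x. cnj (f x)) \<in> borel_measurable torus"
    using assms unfolding L_log_half_L_def
    by (intro measurable_compose[OF _ borel_measurable_continuous_onI[of cnj]]) (auto intro: continuous_intros)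
  then show ?thesis using assms by (simp add: L_log_half_L_def)
qed

text \<open>Conjugation reflects the frequencies, so the positive-frequency bound applied to the
  conjugate function controls the negative frequencies of \<open>f\<close>.\<close>

lemma fourier_coeff_cnj: "fourier_coeff (\<lambda>x. cnj (f x)) n = cnj (fourier_coeff f (- n))"
proof -
  have "(LINT \<theta>|torus. cnj (f \<theta>) * cis (- (of_int n * \<theta>)))
      = (LINT \<theta>|torus. cnj (f \<theta> * cis (- (of_int (- n) * \<theta>))))"
    by (simp add: cis_cnj)
  also have "\<dots> = cnj (LINT \<theta>|torus. f \<theta> * cis (- (of_int (- n) * \<theta>)))"
    by (rule Bochner_Integration.integral_cnj)
  finally show ?thesis by (simp add: fourier_coeff_def)
qed

theorem mainTheorem3:
  fixes m :: "int \<Rightarrow> complex"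
  assumes "\<And>n. n \<noteq> 0 \<Longrightarrow> m n = complex_of_real (1 / sqrt (real_of_int \<bar>n\<bar>))"
    and "m 0 = 0"
  shows "multiplier_L_log_half_L_L2 m \<and> \<not> sidon_weight m"
proof
  \<comment> \<open>The formula includes \<open>n = 0\<close>, where both sides vanish because
    \<open>1 / 0 = 0\<close>.\<close>
  have m_sq: "(cmod (m n))\<^sup>2 = 1 / real_of_int \<bar>n\<bar>" for n
    using assms by (cases "n = 0") (auto simp: power_divide norm_divide)
  have supp_m: "supp m = - {0}"
    using assms by (force simp: supp_def)
  show "multiplier_L_log_half_L_L2 m"
    unfolding multiplier_L_log_half_L_L2_def
  proof (intro conjI ballI)
    have "(cmod (m n))\<^sup>2 \<le> 1\<^sup>2" for n
      unfolding m_sq by (cases "n = 0") auto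
    then have "cmod (m n) \<le> 1" for n by (rule power2_le_imp_le) simp
    then show "bounded (range m)" by (auto simp: bounded_iff)
    fix f assume f: "f \<in> L_log_half_L"
    obtain K where K: "\<And>N. (\<Sum>n=1..N. (cmod (fourier_coeff f (int n)))\<^sup>2 / real n) \<le> K"
      using fourier_coeff_square_partial_sums_bounded[OF f] by blast
    obtain K' where K': "\<And>N. (\<Sum>n=1..N. (cmod (fourier_coeff (\<lambda>x. cnj (f x)) (int n)))\<^sup>2 / real n) \<le> K'"
      using fourier_coeff_square_partial_sums_bounded[OF L_log_half_L_cnj[OF f]] by blast
    let ?t = "\<lambda>n. (cmod (m n * fourier_coeff f n))\<^sup>2"
    have t: "?t n = (cmod (fourier_coeff f n))\<^sup>2 / real_of_int \<bar>n\<bar>" for n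
      by (simp add: norm_mult power_mult_distrib m_sq)
    show "?t summable_on UNIV"
    proof (rule nonneg_bounded_partial_sums_imp_summable_on[where C = "K + K'"])
      have "sum ?t X \<le> K + K'" if X: "finite X" for X
      proof -
        obtain N where N: "\<And>n. n \<in> X \<Longrightarrow> \<bar>n\<bar> \<le> int N"
        proof
          fix n assume "n \<in> X"
          then have "nat \<bar>n\<bar> \<le> Max (insert 0 ((\<lambda>n. nat \<bar>n\<bar>) ` X))"
            using X by (intro Max_ge) auto
          then show "\<bar>n\<bar> \<le> int (Max (insert 0 ((\<lambda>n. nat \<bar>n\<bar>) ` X)))" by linarith
        qed
        have XN: "X \<subseteq> {0} \<union> (int ` {1..N} \<union> (\<lambda>n. - int n) ` {1..N})"
        proof
          fix n assume "n \<in> X"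
          then have "\<bar>n\<bar> \<le> int N" by (rule N)
          then have "n = 0 \<or> n = int (nat n) \<and> nat n \<in> {1..N}
              \<or> n = - int (nat (- n)) \<and> nat (- n) \<in> {1..N}"
            unfolding atLeastAtMost_iff by linarith
          then show "n \<in> {0} \<union> (int ` {1..N} \<union> (\<lambda>n. - int n) ` {1..N})"
            by (elim disjE conjE) blast+
        qed
        \<comment> \<open>Nonnegativity makes the sum subadditive over unions, whether or not the
          pieces are disjoint.\<close>
        have un: "sum ?t (A \<union> B) \<le> sum ?t A + sum ?t B" if "finite A" "finite B" for A B
          using sum.union_inter[OF that, of ?t] sum_nonneg[of "A \<inter> B" ?t] by simp
        have "sum ?t X \<le> sum ?t ({0} \<union> (int ` {1..N} \<union> (\<lambda>n. - int n) ` {1..N}))"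
          using XN by (intro sum_mono2) auto
        also have "\<dots> \<le> sum ?t {0} + (sum ?t (int ` {1..N}) + sum ?t ((\<lambda>n. - int n) ` {1..N}))"
          by (intro order.trans[OF un] add_left_mono un) auto
        also have "sum ?t (int ` {1..N}) = (\<Sum>n=1..N. (cmod (fourier_coeff f (int n)))\<^sup>2 / real n)"
          unfolding t by (subst sum.reindex) auto
        also have "sum ?t ((\<lambda>n. - int n) ` {1..N})
            = (\<Sum>n=1..N. (cmod (fourier_coeff (\<lambda>x. cnj (f x)) (int n)))\<^sup>2 / real n)"
          unfolding t fourier_coeff_cnj by (subst sum.reindex) (auto simp: inj_on_def)
        finally show ?thesis using K[of N] K'[of N] assms(2) by simp
      qed
      then show "\<forall>\<^sub>F X in finite_subsets_at_top UNIV. sum ?t X \<le> K + K'"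
        by (auto simp: eventually_finite_subsets_at_top)
    qed simp
  qed
  show "\<not> sidon_weight m"
  proof
    assume "sidon_weight m"
    then obtain S where "S > 0" and S: "\<forall>f. trig_polynomial f \<and> supp (fourier_coeff f) \<subseteq> supp m \<longrightarrow>
        ereal (\<Sum>\<^sub>\<infinity>n\<in>supp m. cmod (m n * fourier_coeff f n)) \<le> ereal S * Linf_norm f"
      unfolding sidon_weight_def by blast
    \<comment> \<open>The squared moduli of \<open>m\<close> on the positive integers are exactly
      the terms of the harmonic series, so square summability would bound the harmonic
      numbers.\<close>
    have "harm N \<le> (8 * S)\<^sup>2" for N
    proof -
      have "harm N = (\<Sum>n=1..N. (cmod (m (int n)))\<^sup>2)"
        unfolding harm_def m_sq by (simp add: inverse_eq_divide)
      also have "\<dots> \<le> (8 * S)\<^sup>2"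
        by (rule sidon_weight_imp_square_summable[OF S supp_m]) (use \<open>S > 0\<close> in simp)
      finally show ?thesis .
    qed
    moreover obtain N where "harm N > (8 * S)\<^sup>2"
      using harm_at_top unfolding filterlim_at_top_dense eventually_sequentially by blast
    ultimately show False by (meson not_le)
  qed
qed

end
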